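(* Let $\phi:G\to \mathrm{Aut}(X)$ be an action of a group $G$ on a set $X$. Let $\mathbf{C}=\mathbf{G}$ be the group $G$ regarded as a category with one object $\star$ and $\mathbf{G}(\star,\star)=G$, and let $F:\mathbf{G}\to\mathbf{Set}$ be the functor given by the action, $F(\star)=X$ and $F(g)=\phi_g$, where $\mathbf{Set}$ is regarded as a concrete category over itself via $U=\mathrm{id}_{\mathbf{Set}}$. Then the transformation groupoid $X/\!\!/G$ is isomorphic, as a category, to the base structured category $\int_{\mathbf{C}^{op}}\bar{\mathbb{F}}$.
   Context: The transformation groupoid $X/\!\!/G$ of an action $\phi$ has as objects the elements $x\in X$; a morphism $x\to y$ is a pair $(g,x)\in G\times X$ with $\phi_g(x)=y$; composition is $(g',\phi_g(x))\circ(g,x)=(g'g,x)$. Let $F:\mathbf{C}\to\mathbf{D}$ be a functor and $U:\mathbf{D}\to\mathbf{Set}$ a faithful functor. For a morphism $f:X\to Y$ of $\mathbf{C}$ write $f^{\circ}:Y\to X$ for the corresponding morphism of $\mathbf{C}^{op}$. The associated contravariant functor $\bar{F}$ from $\mathbf{C}^{op}$ to $\mathbf{D}$ is $\bar{F}X=FX$, $\bar{F}f^{\circ}=Ff:\bar FX\to\bar FY$, and $\bar{\mathbb{F}}=U\circ\bar{F}$. The category $\int_{\mathbf{C}^{op}}\bar{\mathbb{F}}$ (concrete right action induced by the functor) has as objects the pairs $(X,x)$ with $X\in\mathrm{Ob}(\mathbf{C}^{op})$ and $x\in\bar{\mathbb{F}}X=U(\bar FX)$; a morphism $(Y,y)\to(X,x)$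 is a pair $(f^{\circ},y)$ with $f^{\circ}:Y\to X$ in $\mathbf{C}^{op}$ and $y=\bar{\mathbb{F}}f^{\circ}(x)$; the identity of $(X,x)$ is $(\mathrm{id}_X,x)$; the composite of $(g^{\circ},z):(Z,z)\to(Y,y)$ followed by $(f^{\circ},y):(Y,y)\to(X,x)$ is $(f^{\circ},y)\bullet(g^{\circ},z)=(f^{\circ}\circ g^{\circ},z)$. *)

theory Defs
  imports "HOL-Algebra.Group_Action"
begin

(* Categories are given by families of hom-sets that need not be disjoint: in the category
   induced by a functor, below, a pair (f, y) need not determine its codomain. For this reason
   composition and the arrow part of a functor carry the objects as arguments:
   Comp C a b c g f is the composite of f : a -> b followed by g : b -> c. *)

record ('o, 'm) cat =
  Obj :: "'o set"
  Hom :: "'o \<Rightarrow> 'o \<Rightarrow> 'm set"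
  Ident :: "'o \<Rightarrow> 'm"
  Comp :: "'o \<Rightarrow> 'o \<Rightarrow> 'o \<Rightarrow> 'm \<Rightarrow> 'm \<Rightarrow> 'm"

definition category :: "('o, 'm) cat \<Rightarrow> bool" where
  "category C \<longleftrightarrow>
     (\<forall>a\<in>Obj C. Ident C a \<in> Hom C a a) \<and>
     (\<forall>a\<in>Obj C. \<forall>b\<in>Obj C. \<forall>c\<in>Obj C. \<forall>f\<in>Hom C a b. \<forall>g\<in>Hom C b c.
        Comp C a b c g f \<in> Hom C a c) \<and>
     (\<forall>a\<in>Obj C. \<forall>b\<in>Obj C. \<forall>f\<in>Hom C a b. Comp C a a b f (Ident C a) = f) \<and>
     (\<forall>a\<in>Obj C. \<forall>b\<in>Obj C. \<forall>f\<in>Hom C a b. Comp C a b b (Ident C b) f = f) \<and>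
     (\<forall>a\<in>Obj C. \<forall>b\<in>Obj C. \<forall>c\<in>Obj C. \<forall>d\<in>Obj C.
        \<forall>f\<in>Hom C a b. \<forall>g\<in>Hom C b c. \<forall>h\<in>Hom C c d.
          Comp C a b d (Comp C b c d h g) f = Comp C a c d h (Comp C a b c g f))"

record ('o, 'm, 'p, 'n) functor_maps =
  obj_map :: "'o \<Rightarrow> 'p"
  arr_map :: "'o \<Rightarrow> 'o \<Rightarrow> 'm \<Rightarrow> 'n"

definition is_functor ::
    "('o, 'm) cat \<Rightarrow> ('p, 'n) cat \<Rightarrow> ('o, 'm, 'p, 'n) functor_maps \<Rightarrow> bool" where
  "is_functor C D F \<longleftrightarrow>
     category C \<and> category D \<and>
     (\<forall>a\<in>Obj C. obj_map F a \<in> Obj D) \<and>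
     (\<forall>a\<in>Obj C. \<forall>b\<in>Obj C. \<forall>f\<in>Hom C a b.
        arr_map F a b f \<in> Hom D (obj_map F a) (obj_map F b)) \<and>
     (\<forall>a\<in>Obj C. arr_map F a a (Ident C a) = Ident D (obj_map F a)) \<and>
     (\<forall>a\<in>Obj C. \<forall>b\<in>Obj C. \<forall>c\<in>Obj C. \<forall>f\<in>Hom C a b. \<forall>g\<in>Hom C b c.
        arr_map F a c (Comp C a b c g f) =
        Comp D (obj_map F a) (obj_map F b) (obj_map F c) (arr_map F b c g) (arr_map F a b f))"

definition faithful_functor ::
    "('o, 'm) cat \<Rightarrow> ('p, 'n) cat \<Rightarrow> ('o, 'm, 'p, 'n) functor_maps \<Rightarrow> bool" where
  "faithful_functor C D F \<longleftrightarrow>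
     is_functor C D F \<and> (\<forall>a\<in>Obj C. \<forall>b\<in>Obj C. inj_on (arr_map F a b) (Hom C a b))"

definition identity_functor :: "('o, 'm, 'o, 'm) functor_maps" where
  "identity_functor = \<lparr>obj_map = (\<lambda>a. a), arr_map = (\<lambda>a b f. f)\<rparr>"

definition mutually_inverse_functors ::
    "('o, 'm) cat \<Rightarrow> ('p, 'n) cat \<Rightarrow>
     ('o, 'm, 'p, 'n) functor_maps \<Rightarrow> ('p, 'n, 'o, 'm) functor_maps \<Rightarrow> bool" where
  "mutually_inverse_functors C D F K \<longleftrightarrow>
     (\<forall>a\<in>Obj C. obj_map K (obj_map F a) = a) \<and>
     (\<forall>a\<in>Obj C. \<forall>b\<in>Obj C. \<forall>f\<in>Hom C a b.
        arr_map K (obj_map F a) (obj_map F b) (arr_map F a b f) = f) \<and>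
     (\<forall>p\<in>Obj D. obj_map F (obj_map K p) = p) \<and>
     (\<forall>p\<in>Obj D. \<forall>q\<in>Obj D. \<forall>h\<in>Hom D p q.
        arr_map F (obj_map K p) (obj_map K q) (arr_map K p q h) = h)"

definition isomorphic_categories :: "('o, 'm) cat \<Rightarrow> ('p, 'n) cat \<Rightarrow> bool" where
  "isomorphic_categories C D \<longleftrightarrow>
     (\<exists>F K. is_functor C D F \<and> is_functor D C K \<and> mutually_inverse_functors C D F K)"

(* The arrow of the opposite category corresponding to f is represented by f itself. *)

definition opposite :: "('o, 'm) cat \<Rightarrow> ('o, 'm) cat" where
  "opposite C = \<lparr>Obj = Obj C,
     Hom = (\<lambda>Y X. Hom C X Y),
     Ident = Ident C,
     Comp = (\<lambda>Z Y X f g. Comp C X Y Z g f)\<rparr>"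

(* The sets are the subsets of the type 'a, an arbitrary universe; functions are taken
   extensional so that equality of arrows is equality on the domain. *)

definition set_category :: "('a set, 'a \<Rightarrow> 'a) cat" where
  "set_category = \<lparr>Obj = UNIV,
     Hom = (\<lambda>A B. A \<rightarrow>\<^sub>E B),
     Ident = (\<lambda>A. \<lambda>x\<in>A. x),
     Comp = (\<lambda>A B C g f. compose A g f)\<rparr>"

(* For F from C to D, the contravariant functor from the opposite of C to D: it sends an arrow
   Y -> X of the opposite category to an arrow from F X to F Y. *)

definition bar_functor :: "('o, 'm, 'p, 'n) functor_maps \<Rightarrow> ('o, 'm, 'p, 'n) functor_maps" where
  "bar_functor F = \<lparr>obj_map = obj_map F, arr_map = (\<lambda>Y X f. arr_map F X Y f)\<rparr>"

(* Composite of a covariant U after a contravariant K. *)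

definition comp_contravariant ::
    "('p, 'n, 'q, 'k) functor_maps \<Rightarrow> ('o, 'm, 'p, 'n) functor_maps \<Rightarrow>
     ('o, 'm, 'q, 'k) functor_maps" where
  "comp_contravariant U K = \<lparr>obj_map = (\<lambda>X. obj_map U (obj_map K X)),
     arr_map = (\<lambda>Y X f. arr_map U (obj_map K X) (obj_map K Y) (arr_map K Y X f))\<rparr>"

definition concrete_right_action ::
    "('o, 'm) cat \<Rightarrow> ('o, 'm, 'p, 'n) functor_maps \<Rightarrow> ('p, 'n, 'a set, 'a \<Rightarrow> 'a) functor_maps \<Rightarrow>
     ('o \<times> 'a, 'm \<times> 'a) cat" where
  "concrete_right_action C F U =
     (let P = opposite C; FF = comp_contravariant U (bar_functor F) in
      \<lparr>Obj = {(X, x). X \<in> Obj P \<and> x \<in> obj_map FF X},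
       Hom = (\<lambda>(Y, y) (X, x). {(f, y') | f y'. f \<in> Hom P Y X \<and> y' = y \<and> y = arr_map FF Y X f x}),
       Ident = (\<lambda>(X, x). (Ident P X, x)),
       Comp = (\<lambda>(Z, z) (Y, y) (X, x) (f, y') (g, z'). (Comp P Z Y X f g, z'))\<rparr>)"

definition group_category :: "('g, 'b) monoid_scheme \<Rightarrow> (unit, 'g) cat" where
  "group_category G = \<lparr>Obj = {()},
     Hom = (\<lambda>_ _. carrier G),
     Ident = (\<lambda>_. \<one>\<^bsub>G\<^esub>),
     Comp = (\<lambda>_ _ _ g' g. g' \<otimes>\<^bsub>G\<^esub> g)\<rparr>"

definition action_functor ::
    "'x set \<Rightarrow> ('g \<Rightarrow> 'x \<Rightarrow> 'x) \<Rightarrow> (unit, 'g, 'x set, 'x \<Rightarrow> 'x) functor_maps" where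
  "action_functor X \<phi> = \<lparr>obj_map = (\<lambda>_. X), arr_map = (\<lambda>_ _ g. \<phi> g)\<rparr>"

definition transformation_groupoid ::
    "('g, 'b) monoid_scheme \<Rightarrow> 'x set \<Rightarrow> ('g \<Rightarrow> 'x \<Rightarrow> 'x) \<Rightarrow> ('x, 'g \<times> 'x) cat" where
  "transformation_groupoid G X \<phi> = \<lparr>Obj = X,
     Hom = (\<lambda>x y. {(g, x') | g x'. g \<in> carrier G \<and> x' = x \<and> \<phi> g x = y}),
     Ident = (\<lambda>x. (\<one>\<^bsub>G\<^esub>, x)),
     Comp = (\<lambda>x y z (g', y') (g, x'). (g' \<otimes>\<^bsub>G\<^esub> g, x'))\<rparr>"

lemma category_set_category: "category (set_category :: ('a set, 'a \<Rightarrow> 'a) cat)"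
  unfolding category_def set_category_def
  by (auto simp: compose_def PiE_iff extensional_def fun_eq_iff)

lemma faithful_identity_functor:
  assumes "category C"
  shows "faithful_functor C C identity_functor"
  using assms
  unfolding faithful_functor_def is_functor_def identity_functor_def category_def
  by (auto simp: inj_on_def)

lemma category_opposite:
  assumes "category C"
  shows "category (opposite C)"
  using assms unfolding category_def opposite_def by simp

lemma category_group_category:
  assumes "group G"
  shows "category (group_category G)"
proof -
  interpret group G by fact
  show ?thesis
    unfolding category_def group_category_def by (auto simp: m_assoc)
qed

lemma is_functor_action_functor:
  assumes "group_action G X \<phi>"
  shows "is_functor (group_category G) set_category (action_functor X \<phi>)"
proof -
  interpret group_action G X \<phi> by fact
  have bij: "\<phi> g \<in> Bij X" if "g \<in> carrier G" for g
    using bij_prop0 [OF that] group_hom.hom_closed [OF group_hom that] by (simp add: BijGroup_def)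
  have "\<phi> \<one>\<^bsub>G\<^esub> = (\<lambda>x\<in>X. x)"
    using group_hom.hom_one [OF group_hom] by (simp add: BijGroup_def)
  moreover have "\<phi> g \<in> X \<rightarrow>\<^sub>E X" if "g \<in> carrier G" for g
    using bij [OF that] by (auto simp: Bij_def bij_betw_def PiE_iff)
  moreover have "\<phi> (g' \<otimes>\<^bsub>G\<^esub> g) = compose X (\<phi> g') (\<phi> g)"
    if "g' \<in> carrier G" "g \<in> carrier G" for g g'
    using group_hom.hom_mult [OF group_hom that] bij that by (simp add: BijGroup_def)
  moreover have "category (group_category G)"
    using group_hom by (simp add: group_hom_def category_group_category)
  ultimately show ?thesis
    using category_set_category
    unfolding is_functor_def
    by (simp add: group_category_def set_category_def action_functor_def)
qed

lemma category_concrete_right_action: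
  fixes U :: "('p, 'n, 'a set, 'a \<Rightarrow> 'a) functor_maps"
  assumes F: "is_functor C D F" and U: "faithful_functor D set_category U"
  shows "category (concrete_right_action C F U)"
proof -
  let ?S = "\<lambda>X. obj_map U (obj_map F X)"
  let ?T = "\<lambda>X Y f. arr_map U (obj_map F X) (obj_map F Y) (arr_map F X Y f)"
  have U': "is_functor D set_category U"
    using U by (simp add: faithful_functor_def)
  have id: "?T X X (Ident C X) x = x" if "X \<in> Obj C" "x \<in> ?S X" for X x
    using F U' that by (simp add: is_functor_def set_category_def)
  have comp: "?T X Z (Comp C X Y Z g f) x = ?T Y Z g (?T X Y f x)"
    if "X \<in> Obj C" "Y \<in> Obj C" "Z \<in> Obj C" "f \<in> Hom C X Y" "g \<in> Hom C Y Z" "x \<in> ?S X"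
    for X Y Z f g x
    using F U' that by (simp add: is_functor_def set_category_def compose_def)
  have "category C"
    using F by (simp add: is_functor_def)
  then show ?thesis
    unfolding category_def concrete_right_action_def opposite_def comp_contravariant_def
      bar_functor_def Let_def
    by (auto simp: id comp)
qed

end

theory Submission
  imports Defs
begin

(* An arrow (f, x) : x -> y of the category induced by the functor satisfies x = f y, whereas an
   arrow (g, x) : x -> y of the groupoid satisfies g x = y. Since G is a group, the two conditions
   correspond under f = inv g, and inversion reverses products just as passing to the opposite
   category does. *)

text \<open>Translates between the two arrow conditions: from \<open>\<phi> g x = y\<close> it
  yields \<open>x = \<phi> (inv g) y\<close>, and likewise in the other direction.\<close>

lemma (in group_action) action_inv_cancel:
  assumes "g \<in> carrier G" "x \<in> E"
  shows "\<phi> (inv g) (\<phi> g x) = x"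
  using orbit_sym_aux[OF assms refl] .

lemma category_transformation_groupoid:
  assumes "group_action G X \<phi>"
  shows "category (transformation_groupoid G X \<phi>)"
proof -
  interpret group_action G X \<phi> by fact
  interpret group G using group_hom by (simp add: group_hom_def)
  have "\<phi> \<one>\<^bsub>G\<^esub> x = x" if "x \<in> X" for x
    using that by (simp flip: id_eq_one)
  then show ?thesis
    unfolding category_def transformation_groupoid_def
    by (auto simp: m_assoc composition_rule)
qed

text \<open>Flattens the layers of definitions once, so that the functor laws below reduce to group
  identities. Using \<open>snd p\<close> instead of matching on pairs lets the equation rewrite at
  arbitrary objects.\<close>

lemma concrete_right_action_action_functor:
  "concrete_right_action (group_category G) (action_functor X \<phi>) identity_functor =
     \<lparr>Obj = UNIV \<times> X,
      Hom = (\<lambda>p q. {(f, x). f \<in> carrier G \<and> x = snd p \<and> x = \<phi> f (snd q)}),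
      Ident = (\<lambda>p. (\<one>\<^bsub>G\<^esub>, snd p)),
      Comp = (\<lambda>_ _ _ (f, _) (g, x). (g \<otimes>\<^bsub>G\<^esub> f, x))\<rparr>"
  unfolding concrete_right_action_def group_category_def action_functor_def identity_functor_def
    opposite_def comp_contravariant_def bar_functor_def Let_def
  by (auto simp: fun_eq_iff)

theorem proposition15:
  fixes G :: "('g, 'b) monoid_scheme" and X :: "'x set" and \<phi> :: "'g \<Rightarrow> 'x \<Rightarrow> 'x"
  assumes "group_action G X \<phi>"
  shows "isomorphic_categories
           (transformation_groupoid G X \<phi>)
           (concrete_right_action (group_category G) (action_functor X \<phi>)
              (identity_functor :: ('x set, 'x \<Rightarrow> 'x, 'x set, 'x \<Rightarrow> 'x) functor_maps))"
    (is "isomorphic_categories ?T ?A")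
proof -
  interpret group_action G X \<phi> by fact
  interpret group G using group_hom by (simp add: group_hom_def)
  \<comment> \<open>Only the group element is inverted: in both categories the second component of
    an arrow records its source, which stays the same.\<close>
  define F :: "('x, 'g \<times> 'x, unit \<times> 'x, 'g \<times> 'x) functor_maps"
    where "F = \<lparr>obj_map = Pair (), arr_map = (\<lambda>_ _ (g, x). (inv\<^bsub>G\<^esub> g, x))\<rparr>"
  define K :: "(unit \<times> 'x, 'g \<times> 'x, 'x, 'g \<times> 'x) functor_maps"
    where "K = \<lparr>obj_map = snd, arr_map = (\<lambda>_ _ (f, x). (inv\<^bsub>G\<^esub> f, x))\<rparr>"
  have T: "category ?T"
    using assms by (rule category_transformation_groupoid)
  have A: "category ?A"
    by (rule category_concrete_right_action [OF is_functor_action_functor [OF assms]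
          faithful_identity_functor [OF category_set_category]])
  note defs = F_def K_def transformation_groupoid_def concrete_right_action_action_functor
  have "is_functor ?T ?A F"
    using T A unfolding is_functor_def
    by (auto simp: defs inv_mult_group action_inv_cancel element_image)
  \<comment> \<open>If \<open>x = \<phi> f y\<close>, then \<open>action_inv_cancel\<close> gives
    \<open>\<phi> (inv f) x = y\<close>, so \<open>(inv f, x)\<close> is an arrow from
    \<open>x\<close> to \<open>y\<close>.\<close>
  moreover have "is_functor ?A ?T K"
    using T A unfolding is_functor_def
    by (auto simp: defs inv_mult_group action_inv_cancel element_image)
  moreover have "mutually_inverse_functors ?T ?A F K"
    unfolding mutually_inverse_functors_def by (auto simp: defs)
  ultimately show ?thesis
    unfolding isomorphic_categories_def by blast
qed

end
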